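(* Let $G$ be a subcubic graph of order $n$. Then every connected coalition partition of $G$ has at most $\max\{6,\lfloor (n+7)/3\rfloor\}$ sets, i.e. $CC(G)\le \max\{6,\lfloor (n+7)/3\rfloor\}$. Moreover, if $CC(G)=k>6$, then for every connected coalition partition $\pi$ of $G$ with $k$ sets, $CCG(G,\pi)\cong S_k$. The bound is sharp: for every $n\in\{6,8\}$ and every $n\ge 10$ there is a subcubic graph $G$ of order $n$ with $CC(G)=\max\{6,\lfloor (n+7)/3\rfloor\}$.
   Context: All graphs are finite and simple. A graph is subcubic if it is connected and its maximum vertex degree is at most 3. For a graph $G$ with vertex set $V$ and $S\subseteq V$, $G[S]$ denotes the induced subgraph. A set $D\subseteq V$ is dominating if every vertex of $V\setminus D$ has a neighbour in $D$; it is a connected dominating set if moreover $G[D]$ is connected. Two disjoint subsets $A,B\subseteq V$ form a connected coalition if neither $A$ nor $B$ is a connected dominating set but $A\cup B$ is a connected dominating set. A connected coalition partition of $G$ is a partition $\pi=\{V_1,\dots,V_k\}$ of $V$ such that each $V_i$ either is a connected dominating set consisting of a single vertex, or forms a connected coalition with some set of $\pi$. The coalition graph $CCG(G,\pi)$ has vertex set $\{V_1,\dots,V_k\}$, with $V_i$ and $V_j$ adjacent if and only if they form a connected coalition in $G$. The connected coalition number $CC(G)$ is the largest number of sets in a connected coalition partition of $G$. $S_k$ denotes the star of order $k$ (i.e. $K_{1,k-1}$). *)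

theory Defs
  imports
    "Graph_Theory.Digraph_Isomorphism"
    "HOL-Library.Disjoint_Sets"
begin

text \<open>
  A finite simple graph is a \<open>pair_graph\<close>: finitely many vertices and a symmetric irreflexive
  arc relation, each edge being represented by its two opposite arcs. Hence the degree of a vertex
  is its out-degree. The predicate \<open>connected\<close> is false for the graph without vertices.
\<close>

definition subcubic :: "'a pair_pre_digraph \<Rightarrow> bool" where
  "subcubic G \<longleftrightarrow>
     pair_graph G \<and> connected (with_proj G) \<and>
     (\<forall>v \<in> pverts G. out_degree (with_proj G) v \<le> 3)"

definition dominating_set :: "'a pair_pre_digraph \<Rightarrow> 'a set \<Rightarrow> bool" where
  "dominating_set G D \<longleftrightarrow>
     D \<subseteq> pverts G \<and> (\<forall>v \<in> pverts G - D. \<exists>u \<in> D. (v, u) \<in> parcs G)"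

definition connected_dominating_set :: "'a pair_pre_digraph \<Rightarrow> 'a set \<Rightarrow> bool" where
  "connected_dominating_set G D \<longleftrightarrow>
     dominating_set G D \<and> connected (with_proj G \<restriction> D)"

definition connected_coalition :: "'a pair_pre_digraph \<Rightarrow> 'a set \<Rightarrow> 'a set \<Rightarrow> bool" where
  "connected_coalition G A B \<longleftrightarrow>
     A \<subseteq> pverts G \<and> B \<subseteq> pverts G \<and> A \<inter> B = {} \<and>
     \<not> connected_dominating_set G A \<and> \<not> connected_dominating_set G B \<and>
     connected_dominating_set G (A \<union> B)"

definition connected_coalition_partition :: "'a pair_pre_digraph \<Rightarrow> 'a set set \<Rightarrow> bool" where
  "connected_coalition_partition G \<pi> \<longleftrightarrow>
     partition_on (pverts G) \<pi> \<and>
     (\<forall>A \<in> \<pi>. (card A = 1 \<and> connected_dominating_set G A) \<or>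
             (\<exists>B \<in> \<pi>. connected_coalition G A B))"

definition CCG :: "'a pair_pre_digraph \<Rightarrow> 'a set set \<Rightarrow> 'a set pair_pre_digraph" where
  "CCG G \<pi> =
     \<lparr> pverts = \<pi>, parcs = {(A, B). A \<in> \<pi> \<and> B \<in> \<pi> \<and> connected_coalition G A B} \<rparr>"

text \<open>
  Some graphs, such as the path with three vertices, have no connected coalition partition at all;
  their connected coalition number is 0, the supremum of the empty set of naturals. For finite
  \<open>G\<close> the set below is finite, so that otherwise the supremum is its maximum.
\<close>

definition CC :: "'a pair_pre_digraph \<Rightarrow> nat" where
  "CC G = Sup {card \<pi> | \<pi>. connected_coalition_partition G \<pi>}"

text \<open>The star with \<open>k\<close> vertices in total, that is, with \<open>k - 1\<close> leaves around the centre 0.\<close>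

definition star :: "nat \<Rightarrow> nat pair_pre_digraph" where
  "star k =
     \<lparr> pverts = {..<k},
       parcs = {(0, i) | i. 0 < i \<and> i < k} \<union> {(i, 0) | i. 0 < i \<and> i < k} \<rparr>"

end

theory Submission
  imports Defs
begin

text \<open>
  Growing a connected set vertex by vertex shows that a connected set \<open>D\<close> of a subcubic graph has
  at most \<open>2 |D| + 2\<close> vertices in its closed neighbourhood; in particular \<open>n \<le> 2 |D| + 2\<close> if \<open>D\<close>
  dominates. Two disjoint edges of the coalition graph therefore exhaust all but two vertices, so
  that a partition into more than six sets has a coalition graph without two disjoint edges and
  without isolated vertices, that is, a star. Its centre \<open>A\<close> has \<open>p \<ge> 6\<close> partners. If a vertex \<open>v\<close>
  were not dominated by \<open>A\<close>, each partner would meet its closed neighbourhood, so that \<open>p \<le> 4\<close>.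
  Hence \<open>A\<close> is disconnected. Each partner meets the boundary of every component \<open>K\<close> of \<open>A\<close>, so
  that \<open>p \<le> |K| + 2\<close>; two components and the partners themselves then give
  \<open>n \<ge> 2 (p - 2) + p = 3 p - 4\<close>. Two paths joined through \<open>p\<close> further vertices attain this.
\<close>

section \<open>Connectedness of vertex sets in terms of closed subsets\<close>

text \<open>Cut form of connectedness: one closed proper subset refutes it, and no walks need to be
  handled. The empty set is excluded in agreement with \<open>connected\<close>.\<close>

definition conn :: "'a rel \<Rightarrow> 'a set \<Rightarrow> bool" where
  "conn E D \<longleftrightarrow> D \<noteq> {} \<and> (\<forall>S. S \<subseteq> D \<and> S \<noteq> {} \<and> E `` S \<inter> D \<subseteq> S \<longrightarrow> S = D)"

lemma conn_closed:
  assumes "conn E D" "R \<inter> D \<noteq> {}" "E `` (R \<inter> D) \<inter> D \<subseteq> R"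
  shows "D \<subseteq> R"
proof -
  have "R \<inter> D = D"
    using assms unfolding conn_def by (elim conjE allE[of _ "R \<inter> D"]) blast
  then show ?thesis by blast
qed

lemma conn_singleton: "conn E {v}"
  by (auto simp: conn_def)

lemma conn_Un:
  assumes "sym E" "conn E S" "conn E T" "u \<in> S" "v \<in> T" "(u, v) \<in> E"
  shows "conn E (S \<union> T)"
  unfolding conn_def
proof (intro conjI allI impI)
  show "S \<union> T \<noteq> {}" using \<open>u \<in> S\<close> by auto
next
  fix R assume R: "R \<subseteq> S \<union> T \<and> R \<noteq> {} \<and> E `` R \<inter> (S \<union> T) \<subseteq> R"
  \<comment> \<open>A closed \<open>R\<close> contains both ends of the joining edge or neither, so
    it cannot stop at one side.\<close>
  have uv: "u \<in> R \<longleftrightarrow> v \<in> R"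
    using R assms by (auto dest: symD)
  have "E `` (R \<inter> S) \<inter> S \<subseteq> R" "E `` (R \<inter> T) \<inter> T \<subseteq> R" using R by blast+
  then have "S \<subseteq> R" if "R \<inter> S \<noteq> {}" using conn_closed[OF assms(2) that] by simp
  moreover have "T \<subseteq> R" if "R \<inter> T \<noteq> {}"
    using conn_closed[OF assms(3) that] \<open>E `` (R \<inter> T) \<inter> T \<subseteq> R\<close> by simp
  ultimately have "S \<union> T \<subseteq> R"
    using R uv assms(4,5) by blast
  then show "R = S \<union> T" using R by blast
qed

lemma conn_insert:
  assumes "sym E" "conn E S" "u \<in> S" "(u, v) \<in> E"
  shows "conn E (insert v S)"
  using conn_Un[OF assms(1,2) conn_singleton assms(3) _ assms(4), of v] by simp

text \<open>A nonempty closed set meets \<open>D\<close>, because its vertices outside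
  \<open>D\<close> have neighbours there; hence it contains \<open>D\<close> and then everything
  that \<open>D\<close> dominates.\<close>

lemma conn_dominated:
  assumes "sym E" "conn E D" "D \<subseteq> V" "\<And>v. v \<in> V - D \<Longrightarrow> \<exists>u\<in>D. (v, u) \<in> E"
  shows "conn E V"
  unfolding conn_def
proof (intro conjI allI impI)
  show "V \<noteq> {}" using assms(2,3) by (auto simp: conn_def)
next
  fix R assume R: "R \<subseteq> V \<and> R \<noteq> {} \<and> E `` R \<inter> V \<subseteq> R"
  have "R \<inter> D \<noteq> {}"
  proof -
    obtain x where "x \<in> R" using R by blast
    show ?thesis
    proof (cases "x \<in> D")
      case False
      then obtain u where "u \<in> D" "(x, u) \<in> E" using assms(4)[of x] R \<open>x \<in> R\<close> by blast
      then show ?thesis using R \<open>x \<in> R\<close> assms(3) by blast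
    qed (use \<open>x \<in> R\<close> in blast)
  qed
  moreover have "E `` (R \<inter> D) \<inter> D \<subseteq> R" using R assms(3) by blast
  ultimately have "D \<subseteq> R" by (rule conn_closed[OF assms(2)])
  have "V \<subseteq> R"
  proof
    fix v assume "v \<in> V"
    show "v \<in> R"
    proof (cases "v \<in> D")
      case False
      then obtain u where "u \<in> D" "(u, v) \<in> E"
        using assms(1,4) \<open>v \<in> V\<close> by (blast dest: symD)
      then show ?thesis using R \<open>v \<in> V\<close> \<open>D \<subseteq> R\<close> by blast
    qed (use \<open>D \<subseteq> R\<close> in blast)
  qed
  then show "R = V" using R by blast
qed

text \<open>A set that fails \<open>conn\<close> contains a smaller nonempty closed one, so a
  minimal closed subset of \<open>S\<close> is connected, that is, a component of
  \<open>A\<close>.\<close>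

lemma exists_conn_component:
  assumes "finite A" "S \<subseteq> A" "S \<noteq> {}" "E `` S \<inter> A \<subseteq> S"
  shows "\<exists>K\<subseteq>S. conn E K \<and> E `` K \<inter> A \<subseteq> K"
  using finite_subset[OF assms(2,1)] assms(2-)
proof (induction S rule: finite_psubset_induct)
  case (psubset S)
  show ?case
  proof (cases "conn E S")
    case False
    then obtain T where T: "T \<subset> S" "T \<noteq> {}" "E `` T \<inter> S \<subseteq> T"
      using psubset.prems unfolding conn_def by blast
    then have "T \<subseteq> A" "E `` T \<inter> A \<subseteq> T" using psubset.prems by blast+
    then have "\<exists>K\<subseteq>T. conn E K \<and> E `` K \<inter> A \<subseteq> K"
      using psubset.IH[OF T(1)] T(2) by simp
    then show ?thesis using T(1) by (meson order_trans psubset_imp_subset)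
  qed (use psubset.prems in \<open>intro exI[of _ S], simp\<close>)
qed

text \<open>Walks never leave a closed set; conversely, the vertices reachable from a given one form
  a closed set.\<close>

lemma connected_induce_iff_conn:
  assumes "sym (parcs G)"
  shows "connected (with_proj G \<restriction> D) \<longleftrightarrow> conn (parcs G) D"
proof -
  let ?E = "parcs G" and ?H = "with_proj G \<restriction> D"
  let ?R = "rtrancl_on D (?E \<inter> D \<times> D)"
  have "arcs_ends ?H = ?E \<inter> D \<times> D"
    by (auto simp: arcs_ends_conv induce_subgraph_def)
  moreover have "(?E \<inter> D \<times> D)\<^sup>s = ?E \<inter> D \<times> D"
    using assms by (auto simp: symcl_def sym_def)
  ultimately have *: "connected ?H \<longleftrightarrow> D \<noteq> {} \<and> (\<forall>u\<in>D. \<forall>v\<in>D. (u, v) \<in> ?R)"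
    by (simp add: connected_conv)
  show ?thesis
  proof
    assume l: "connected ?H"
    show "conn ?E D"
      unfolding conn_def
    proof (intro conjI allI impI)
      show "D \<noteq> {}" using l * by simp
    next
      fix S assume S: "S \<subseteq> D \<and> S \<noteq> {} \<and> ?E `` S \<inter> D \<subseteq> S"
      then obtain u where u: "u \<in> S" by blast
      have "v \<in> S" if "(u, v) \<in> ?R" for v
        using that
      proof (induction rule: rtrancl_on_induct)
        case base then show ?case using u by simp
      next
        case (step y z) then show ?case using S by blast
      qed
      then show "S = D" using l * u S by blast
    qed
  next
    assume r: "conn ?E D"
    have "(u, v) \<in> ?R" if "u \<in> D" "v \<in> D" for u v
    proof -
      have "D \<subseteq> {w. (u, w) \<in> ?R}"
        using that by (intro conn_closed[OF r])
          (auto intro: rtrancl_on_into_rtrancl_on)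
      then show ?thesis using that by blast
    qed
    then show "connected ?H" using * r by (auto simp: conn_def)
  qed
qed

lemma connected_dominating_set_iff:
  assumes "sym (parcs G)"
  shows "connected_dominating_set G D \<longleftrightarrow>
    D \<subseteq> pverts G \<and> (\<forall>v\<in>pverts G - D. \<exists>u\<in>D. (v, u) \<in> parcs G) \<and> conn (parcs G) D"
  by (auto simp: connected_dominating_set_def dominating_set_def connected_induce_iff_conn[OF assms])

lemma out_degree_with_proj: "out_degree (with_proj G) v = card (parcs G `` {v})"
proof -
  have "out_arcs (with_proj G) v = Pair v ` (parcs G `` {v})"
    by (auto simp: out_arcs_def)
  then show ?thesis by (simp add: out_degree_def card_image inj_on_def)
qed

section \<open>Counting in subcubic graphs\<close>

text \<open>Disjointness makes the choice of one point of \<open>X\<close> per member injective.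
  Typical \<open>X\<close> below are closed neighbourhoods, boundaries and complements.\<close>

lemma card_disjoint_hitting:
  assumes "disjoint \<P>" "finite X" "\<And>B. B \<in> \<P> \<Longrightarrow> B \<inter> X \<noteq> {}"
  shows "card \<P> \<le> card X"
proof -
  have "\<forall>B\<in>\<P>. \<exists>x. x \<in> B \<inter> X" using assms(3) by blast
  then obtain f where f: "\<forall>B\<in>\<P>. f B \<in> B \<inter> X"
    by (auto dest!: bchoice)
  have "inj_on f \<P>"
    using f assms(1) by (intro inj_onI) (metis IntD1 disjointD disjoint_iff_not_equal)
  then show ?thesis using f assms(2) by (intro card_inj_on_le[of f]) auto
qed

text \<open>A set grown along edges gains at most two new vertices in its closed neighbourhood per step.\<close>

lemma card_closed_neighbourhood:
  assumes "sym E" "\<And>v. finite (E `` {v})" "\<And>v. card (E `` {v}) \<le> 3"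
    and "conn E D" "finite D"
  shows "card (D \<union> E `` D) \<le> 2 * card D + 2"
proof -
  have "\<exists>S\<subseteq>D. card S = j \<and> card (S \<union> E `` S) \<le> 2 * j + 2" if "1 \<le> j" "j \<le> card D" for j
    using that
  proof (induction j rule: dec_induct)
    case base
    obtain v where "v \<in> D" using \<open>conn E D\<close> by (auto simp: conn_def)
    moreover have "card ({v} \<union> E `` {v}) \<le> 2 * 1 + 2"
      using card_Un_le[of "{v}" "E `` {v}"] assms(3)[of v] by simp
    ultimately show ?case by (intro exI[of _ "{v}"]) auto
  next
    case (step j)
    then obtain S where S: "S \<subseteq> D" "card S = j" "card (S \<union> E `` S) \<le> 2 * j + 2" by auto
    have "S \<noteq> D" "S \<noteq> {}" using S step by auto
    then have "\<not> E `` S \<inter> D \<subseteq> S" using S \<open>conn E D\<close> by (auto simp: conn_def)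
    then obtain u w where uw: "u \<in> S" "w \<in> D" "w \<notin> S" "(u, w) \<in> E" by blast
    then have "(w, u) \<in> E" using assms(1) by (blast dest: symD)
    \<comment> \<open>\<open>w\<close> is already counted as a neighbour of \<open>u\<close>, and
      \<open>u\<close> is among the at most three neighbours of \<open>w\<close>, so at most two
      vertices are new.\<close>
    have "insert w S \<union> E `` insert w S = (S \<union> E `` S) \<union> (E `` {w} - {u})"
      using uw by blast
    then have "card (insert w S \<union> E `` insert w S) \<le> (2 * j + 2) + card (E `` {w} - {u})"
      using card_Un_le[of "S \<union> E `` S" "E `` {w} - {u}"] S(3) by simp
    moreover have "card (E `` {w} - {u}) \<le> 2"
      using assms(2,3)[of w] \<open>(w, u) \<in> E\<close> by (simp add: card_Diff_singleton)
    moreover have "card (insert w S) = Suc j"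
      using uw S finite_subset[OF S(1) \<open>finite D\<close>] by simp
    ultimately show ?case using S uw by (intro exI[of _ "insert w S"]) auto
  qed
  moreover have "1 \<le> card D"
    using assms(4,5) by (auto simp: conn_def Suc_le_eq card_gt_0_iff)
  ultimately obtain S where "S \<subseteq> D" "card S = card D" "card (S \<union> E `` S) \<le> 2 * card D + 2"
    by blast
  then show ?thesis using card_subset_eq[OF \<open>finite D\<close>] by metis
qed

locale subcubic_pair_graph = pair_graph G for G :: "'a pair_pre_digraph" (structure) +
  assumes out_degree_le: "v \<in> pverts G \<Longrightarrow> out_degree (with_proj G) v \<le> 3"
begin

abbreviation "V \<equiv> pverts G"
abbreviation "E \<equiv> parcs G"

lemma sym_E: "sym E"
  using arcs_symmetric by (blast intro: symI)

lemma E_subset: "E \<subseteq> V \<times> V"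
  by (auto dest: in_arcsD1 in_arcsD2)

lemma finite_nbrs: "finite (E `` S)"
  using finite_subset[of "E `` S" V] E_subset pair_finite_verts by blast

lemma card_nbrs: "card (E `` {v}) \<le> 3"
proof (cases "v \<in> V")
  case True
  then show ?thesis using out_degree_le[OF True] by (simp add: out_degree_with_proj)
next
  case False
  then have "E `` {v} = {}" using E_subset by blast
  then show ?thesis by simp
qed

lemmas cds_iff = connected_dominating_set_iff[OF sym_E]

text \<open>The closed neighbourhood of a connected dominating set is all of \<open>V\<close>.
  Besides the upper bound, this shows that small blocks of the examples are not connected dominating
  sets.\<close>

lemma card_le_connected_dominating_set:
  assumes "connected_dominating_set G D"
  shows "card V \<le> 2 * card D + 2"
proof -
  have D: "D \<subseteq> V" "conn E D" "V \<subseteq> D \<union> E `` D"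
    using assms sym_E unfolding cds_iff by (blast dest: symD)+
  then have "finite D" using finite_subset pair_finite_verts by blast
  have "card V \<le> card (D \<union> E `` D)"
    using D \<open>finite D\<close> finite_nbrs by (intro card_mono) auto
  also have "\<dots> \<le> 2 * card D + 2"
    by (intro card_closed_neighbourhood sym_E finite_nbrs card_nbrs D \<open>finite D\<close>)
  finally show ?thesis .
qed

text \<open>The first alternative arises if \<open>A\<close> does not dominate, the second if it
  dominates but is disconnected.\<close>

lemma coalition_partners_le:
  assumes "A \<noteq> {}" "disjoint \<P>" "\<P> \<noteq> {}" "\<And>B. B \<in> \<P> \<Longrightarrow> connected_coalition G A B"
  shows "card \<P> \<le> 4 \<or> 3 * card \<P> \<le> card V + 4"
proof -
  have A: "A \<subseteq> V" "\<not> connected_dominating_set G A"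
    using assms(3,4) by (auto simp: connected_coalition_def)
  have "finite A" using A finite_subset pair_finite_verts by blast
  have B: "B \<subseteq> V" "A \<inter> B = {}" "connected_dominating_set G (A \<union> B)" if "B \<in> \<P>" for B
    using assms(4)[OF that] by (auto simp: connected_coalition_def)
  show ?thesis
  proof (cases "\<forall>v\<in>V - A. \<exists>u\<in>A. (v, u) \<in> E")
    case False
    then obtain v where v: "v \<in> V - A" "\<And>u. u \<in> A \<Longrightarrow> (v, u) \<notin> E" by blast
    \<comment> \<open>\<open>A\<close> does not help \<open>v\<close>, so each partner contains
      \<open>v\<close> or one of its at most three neighbours.\<close>
    have "card \<P> \<le> card (insert v (E `` {v}))"
    proof (rule card_disjoint_hitting[OF assms(2)])
      fix B assume "B \<in> \<P>"
      then show "B \<inter> insert v (E `` {v}) \<noteq> {}"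
        using B(3) v unfolding cds_iff by blast
    qed (simp add: finite_nbrs)
    also have "\<dots> \<le> 4"
      using card_insert_le_m1[of 4 "E `` {v}" v] card_nbrs[of v] by simp
    finally show ?thesis ..
  next
    case True
    \<comment> \<open>\<open>A \<union> B\<close> is connected and not inside the component
      \<open>K\<close>, so an edge leaves \<open>K\<close> within it. As \<open>K\<close> is closed
      in \<open>A\<close>, that edge ends in \<open>B\<close>; thus every partner meets the boundary
      of \<open>K\<close>.\<close>
    have *: "card \<P> \<le> card K + 2" if K: "K \<subseteq> A" "K \<noteq> A" "conn E K" "E `` K \<inter> A \<subseteq> K" for K
    proof -
      have "finite K" using K \<open>finite A\<close> finite_subset by blast
      have "card \<P> \<le> card (E `` K - K)"
      proof (rule card_disjoint_hitting[OF assms(2)])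
        fix B assume "B \<in> \<P>"
        have "\<not> A \<union> B \<subseteq> K" using K by blast
        moreover have "conn E (A \<union> B)"
          using B(3)[OF \<open>B \<in> \<P>\<close>] by (simp add: cds_iff)
        moreover have "K \<noteq> {}" using K(3) by (simp add: conn_def)
        ultimately have "\<not> E `` (K \<inter> (A \<union> B)) \<inter> (A \<union> B) \<subseteq> K"
          using conn_closed[of E "A \<union> B" K] K(1) by blast
        then show "B \<inter> (E `` K - K) \<noteq> {}" using K(4) by blast
      qed (simp add: finite_nbrs)
      moreover have "K \<union> E `` K = K \<union> (E `` K - K)" by blast
      then have "card (K \<union> E `` K) = card K + card (E `` K - K)"
        using card_Un_disjoint[of K "E `` K - K"] \<open>finite K\<close> finite_nbrs by auto
      moreover have "card (K \<union> E `` K) \<le> 2 * card K + 2"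
        by (intro card_closed_neighbourhood sym_E finite_nbrs card_nbrs K \<open>finite K\<close>)
      ultimately show ?thesis by simp
    qed
    \<comment> \<open>\<open>A\<close> dominates, so only disconnectedness keeps it from being a
      connected dominating set.\<close>
    have "\<not> conn E A" using True A by (simp add: cds_iff)
    then obtain S where S: "S \<subset> A" "S \<noteq> {}" "E `` S \<inter> A \<subseteq> S"
      using assms(1) unfolding conn_def by blast
    \<comment> \<open>By symmetry the complement of a closed set is closed, so that either side
      contains a component.\<close>
    have S': "E `` (A - S) \<inter> A \<subseteq> A - S" using S sym_E by (blast dest: symD)
    obtain K where K: "K \<subseteq> S" "conn E K" "E `` K \<inter> A \<subseteq> K"
      using exists_conn_component[of A S E] S \<open>finite A\<close> by blast
    obtain K' where K': "K' \<subseteq> A - S" "conn E K'" "E `` K' \<inter> A \<subseteq> K'"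
      using exists_conn_component[of A "A - S" E] S S' \<open>finite A\<close> by blast
    have "K \<subseteq> A" "K \<noteq> A" "K' \<subseteq> A" "K' \<noteq> A" using K(1) K'(1) S(1,2) by blast+
    then have "card \<P> \<le> card K + 2" "card \<P> \<le> card K' + 2"
      using *[OF _ _ K(2,3)] *[OF _ _ K'(2,3)] by simp_all
    moreover have "finite K" "finite K'" "K \<inter> K' = {}"
      using \<open>K \<subseteq> A\<close> \<open>K' \<subseteq> A\<close> \<open>finite A\<close> K(1) K'(1) by (auto intro: finite_subset)
    then have "card K + card K' = card (K \<union> K')"
      by (rule card_Un_disjoint[symmetric])
    moreover have "card (K \<union> K') \<le> card A"
      using \<open>K \<subseteq> A\<close> \<open>K' \<subseteq> A\<close> by (intro card_mono \<open>finite A\<close>) blast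
    moreover have "card \<P> \<le> card (V - A)"
    proof (rule card_disjoint_hitting[OF assms(2)])
      fix B assume "B \<in> \<P>"
      \<comment> \<open>With \<open>B\<close> empty, \<open>A\<close> itself would be a connected
        dominating set.\<close>
      have "B \<noteq> {}" using B(3)[OF \<open>B \<in> \<P>\<close>] A(2) by auto
      then show "B \<inter> (V - A) \<noteq> {}" using B[OF \<open>B \<in> \<P>\<close>] by blast
    qed (simp add: pair_finite_verts)
    moreover have "card (V - A) = card V - card A" "card A \<le> card V"
      using A(1) pair_finite_verts \<open>finite A\<close> by (auto intro: card_Diff_subset card_mono)
    \<comment> \<open>With \<open>p = card \<P>\<close>: \<open>2 * (p - 2) \<le> card A\<close>
      from the two components and \<open>p \<le> card V - card A\<close> from the partners.\<close>
    ultimately show ?thesis by linarith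
  qed
qed

end

section \<open>Relations without two disjoint edges\<close>

text \<open>Pairwise meeting edges form a star or a triangle. A triangle would leave a fourth
  element without a partner, and a star without isolated elements is spanning.\<close>

lemma exists_star_centre:
  fixes R :: "'b \<Rightarrow> 'b \<Rightarrow> bool"
  assumes sym: "\<And>x y. R x y \<Longrightarrow> R y x" and irrefl: "\<And>x. \<not> R x x"
    and partner: "\<And>x. x \<in> P \<Longrightarrow> \<exists>y\<in>P. R x y"
    and meet: "\<And>a b c d. \<lbrakk>a \<in> P; b \<in> P; c \<in> P; d \<in> P; R a b; R c d\<rbrakk> \<Longrightarrow> {a, b} \<inter> {c, d} \<noteq> {}"
    and card: "4 \<le> card P"
  shows "\<exists>z\<in>P. \<forall>x\<in>P. \<forall>y\<in>P. R x y \<longleftrightarrow> x \<noteq> y \<and> (x = z \<or> y = z)"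
proof -
  have large: "\<exists>x\<in>P. x \<notin> X" if "finite X" "card X \<le> 3" for X
  proof (rule ccontr)
    assume "\<not> (\<exists>x\<in>P. x \<notin> X)"
    then have "card P \<le> card X" using that(1) by (intro card_mono) auto
    then show False using that(2) card by simp
  qed
  obtain a where "a \<in> P" using large[of "{}"] by auto
  then obtain b where ab: "a \<in> P" "b \<in> P" "R a b" using partner by blast
  have other: "R x a \<or> R x b" if x: "x \<in> P" "x \<noteq> a" "x \<noteq> b" for x
  proof -
    obtain y where "y \<in> P" "R x y" using partner[OF x(1)] by blast
    then show ?thesis using meet[OF x(1) _ ab(1,2) _ ab(3)] x by blast
  qed
  obtain z where z: "z \<in> P" "\<And>x. \<lbrakk>x \<in> P; x \<noteq> z\<rbrakk> \<Longrightarrow> R x z"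
  proof (cases "\<forall>x\<in>P. x \<noteq> a \<longrightarrow> R x a")
    case True
    then show ?thesis using that[of a] ab by blast
  next
    case False
    then obtain c where c: "c \<in> P" "c \<noteq> a" "\<not> R c a" by blast
    then have "c \<noteq> b" "R c b" using ab sym other by blast+
    have "R x b" if "x \<in> P" "x \<noteq> b" for x
    proof (rule ccontr)
      assume "\<not> R x b"
      then have "x \<noteq> a" "x \<noteq> c" using ab \<open>R c b\<close> by blast+
      then have "R x a" using other that \<open>\<not> R x b\<close> by blast
      then show False
        using meet[OF that(1) ab(1) c(1) ab(2) _ \<open>R c b\<close>] \<open>x \<noteq> c\<close> that(2) \<open>c \<noteq> a\<close> ab irrefl by blast
    qed
    then show ?thesis using that[of b] ab by blast
  qed
  have "x = z \<or> y = z" if "x \<in> P" "y \<in> P" "R x y" for x y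
  proof (rule ccontr)
    assume *: "\<not> (x = z \<or> y = z)"
    \<comment> \<open>A fourth element \<open>w\<close> is related to \<open>z\<close>, and this
      edge is disjoint from the one between \<open>x\<close> and \<open>y\<close>.\<close>
    obtain w where w: "w \<in> P" "w \<notin> {x, y, z}"
      using large[of "{x, y, z}"] card_length[of "[x, y, z]"] by auto
    then show False using meet[OF w(1) z(1) that(1,2) _ that(3)] z(2)[OF w(1)] * by blast
  qed
  then show ?thesis using z sym irrefl by blast
qed

section \<open>The upper bound and the star-shaped coalition graph\<close>

context subcubic_pair_graph
begin

lemma card_disjoint_le:
  assumes "disjoint \<P>" "X \<subseteq> V" "\<And>B. B \<in> \<P> \<Longrightarrow> B \<inter> X \<noteq> {}"
  shows "card \<P> \<le> card X"
  using assms finite_subset[OF _ pair_finite_verts] by (intro card_disjoint_hitting) auto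

lemma connected_coalition_commute: "connected_coalition G A B \<longleftrightarrow> connected_coalition G B A"
  by (auto simp: connected_coalition_def Un_commute)

text \<open>Two disjoint edges of the coalition graph give two disjoint connected dominating sets, each
  containing at least \<open>(n - 2) / 2\<close> vertices, so that at most two vertices remain.\<close>

lemma card_le_6_if_disjoint_coalitions:
  assumes \<pi>: "partition_on V \<pi>"
    and in_\<pi>: "A \<in> \<pi>" "B \<in> \<pi>" "C \<in> \<pi>" "D \<in> \<pi>"
    and coal: "connected_coalition G A B" "connected_coalition G C D"
    and disj: "{A, B} \<inter> {C, D} = {}"
  shows "card \<pi> \<le> 6"
proof -
  have dis: "disjoint \<pi>" and sub: "\<And>X. X \<in> \<pi> \<Longrightarrow> X \<subseteq> V" and ne: "{} \<notin> \<pi>"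
    using \<pi> by (auto simp: partition_on_def)
  have d: "X \<inter> Y = {}" if "X \<in> \<pi>" "Y \<in> \<pi>" "X \<noteq> Y" for X Y
    using dis that by (auto dest: disjointD)
  let ?D1 = "A \<union> B" and ?D2 = "C \<union> D" and ?\<rho> = "\<pi> - {A, B, C, D}"
  have "card V \<le> 2 * card ?D1 + 2" "card V \<le> 2 * card ?D2 + 2"
    using coal card_le_connected_dominating_set[of ?D1] card_le_connected_dominating_set[of ?D2]
    by (simp_all add: connected_coalition_def)
  moreover have D12: "?D1 \<subseteq> V" "?D2 \<subseteq> V" using sub in_\<pi> by blast+
  then have fin: "finite ?D1" "finite ?D2" using finite_subset pair_finite_verts by blast+
  have "?D1 \<inter> ?D2 = {}" using d in_\<pi> disj by auto
  then have "card (?D1 \<union> ?D2) = card ?D1 + card ?D2"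
    using fin by (intro card_Un_disjoint)
  moreover have "card (V - (?D1 \<union> ?D2)) = card V - card (?D1 \<union> ?D2)"
    using fin D12 by (intro card_Diff_subset) auto
  moreover have "card ?\<rho> \<le> card (V - (?D1 \<union> ?D2))"
  proof (rule card_disjoint_le)
    show "disjoint ?\<rho>" by (rule pairwise_subset[OF dis]) auto
    fix X assume X: "X \<in> ?\<rho>"
    then have "X \<inter> A = {}" "X \<inter> B = {}" "X \<inter> C = {}" "X \<inter> D = {}" using d in_\<pi> by auto
    moreover have "X \<noteq> {}" "X \<subseteq> V" using X ne sub by auto
    ultimately show "X \<inter> (V - (?D1 \<union> ?D2)) \<noteq> {}" by blast
  qed auto
  \<comment> \<open>At most four sets form the two coalitions, and at most two further sets share
    the remaining vertices.\<close>
  moreover have "card \<pi> - card {A, B, C, D} \<le> card ?\<rho>" by (intro diff_card_le_card_Diff) simp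
  moreover have "card {A, B, C, D} \<le> 4" using card_length[of "[A, B, C, D]"] by simp
  ultimately show ?thesis by linarith
qed

lemma coalition_star:
  assumes ccp: "connected_coalition_partition G \<pi>" and "6 < card \<pi>"
  obtains A where "A \<in> \<pi>"
    "\<And>B C. \<lbrakk>B \<in> \<pi>; C \<in> \<pi>\<rbrakk> \<Longrightarrow> connected_coalition G B C \<longleftrightarrow> B \<noteq> C \<and> (B = A \<or> C = A)"
proof -
  have \<pi>: "partition_on V \<pi>" using ccp by (simp add: connected_coalition_partition_def)
  then have ne: "{} \<notin> \<pi>" by (simp add: partition_on_def)
  have "card \<pi> \<le> card V"
  proof (rule card_disjoint_le)
    show "disjoint \<pi>" using \<pi> by (simp add: partition_on_def)
    show "B \<inter> V \<noteq> {}" if "B \<in> \<pi>" for B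
      using that ne \<pi> by (metis Int_absorb2 Union_upper partition_on_def)
  qed simp
  \<comment> \<open>A single dominating vertex would force \<open>card V \<le> 4\<close>, so every
    set has a coalition partner.\<close>
  then have "\<not> (card A = 1 \<and> connected_dominating_set G A)" for A
    using card_le_connected_dominating_set[of A] \<open>6 < card \<pi>\<close> by auto
  then have partner: "\<exists>B\<in>\<pi>. connected_coalition G A B" if "A \<in> \<pi>" for A
    using ccp that by (auto simp: connected_coalition_partition_def)
  have "\<exists>A\<in>\<pi>. \<forall>B\<in>\<pi>. \<forall>C\<in>\<pi>.
      (B \<in> \<pi> \<and> C \<in> \<pi> \<and> connected_coalition G B C) \<longleftrightarrow> B \<noteq> C \<and> (B = A \<or> C = A)"
  proof (rule exists_star_centre)
    show "\<not> (A \<in> \<pi> \<and> A \<in> \<pi> \<and> connected_coalition G A A)" for A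
      using ne by (auto simp: connected_coalition_def)
  next
    fix A B C D
    assume "A \<in> \<pi>" "B \<in> \<pi>" "C \<in> \<pi>" "D \<in> \<pi>"
      "A \<in> \<pi> \<and> B \<in> \<pi> \<and> connected_coalition G A B" "C \<in> \<pi> \<and> D \<in> \<pi> \<and> connected_coalition G C D"
    then show "{A, B} \<inter> {C, D} \<noteq> {}"
      using card_le_6_if_disjoint_coalitions[OF \<pi>, of A B C D] \<open>6 < card \<pi>\<close> by linarith
  qed (use partner connected_coalition_commute \<open>6 < card \<pi>\<close> in auto)
  then show thesis using that by auto
qed

lemma card_partition_le:
  assumes ccp: "connected_coalition_partition G \<pi>"
  shows "card \<pi> \<le> max 6 ((card V + 7) div 3)"
proof (cases "6 < card \<pi>")
  case True
  then obtain A where A: "A \<in> \<pi>"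
    "\<And>B C. \<lbrakk>B \<in> \<pi>; C \<in> \<pi>\<rbrakk> \<Longrightarrow> connected_coalition G B C \<longleftrightarrow> B \<noteq> C \<and> (B = A \<or> C = A)"
    using coalition_star[OF ccp] by blast
  have "disjoint \<pi>" "{} \<notin> \<pi>"
    using ccp by (auto simp: connected_coalition_partition_def partition_on_def)
  have *: "card (\<pi> - {A}) = card \<pi> - 1" using A(1) by simp
  have "card (\<pi> - {A}) \<le> 4 \<or> 3 * card (\<pi> - {A}) \<le> card V + 4"
  proof (rule coalition_partners_le)
    show "A \<noteq> {}" using A(1) \<open>{} \<notin> \<pi>\<close> by blast
    show "disjoint (\<pi> - {A})" by (rule pairwise_subset[OF \<open>disjoint \<pi>\<close>]) auto
    have "0 < card (\<pi> - {A})" using * True by simp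
    then show "\<pi> - {A} \<noteq> {}" by force
    show "connected_coalition G A B" if "B \<in> \<pi> - {A}" for B
      using A that by blast
  qed
  \<comment> \<open>There are at least six partners, which excludes the first alternative; the
    second becomes \<open>3 * card \<pi> \<le> card V + 7\<close>.\<close>
  then show ?thesis using * True by auto
qed simp

lemma CC_le: "CC G \<le> max 6 ((card V + 7) div 3)"
  and card_partition_le_CC: "connected_coalition_partition G \<pi> \<Longrightarrow> card \<pi> \<le> CC G"
proof -
  let ?S = "{card \<pi> |\<pi>. connected_coalition_partition G \<pi>}"
  have "bdd_above ?S" 
    by (rule bdd_aboveI[of _ "max 6 ((card V + 7) div 3)"]) (use card_partition_le in blast)
  then show "connected_coalition_partition G \<pi> \<Longrightarrow> card \<pi> \<le> CC G"
    unfolding CC_def by (intro cSup_upper) auto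
  show "CC G \<le> max 6 ((card V + 7) div 3)"
  \<comment> \<open>Least upper bounds are available for nonempty sets only; the supremum of the
    empty set is 0.\<close>
  proof (cases "?S = {}")
    case True
    then show ?thesis unfolding CC_def by (simp only: Sup_nat_empty)
  next
    case False
    then show ?thesis unfolding CC_def by (intro cSup_least) (use card_partition_le in blast)+
  qed
qed

end

section \<open>Isomorphism with the star\<close>

lemma digraph_iso_star:
  assumes "finite \<pi>" "A \<in> \<pi>"
    and R: "\<And>B C. \<lbrakk>B \<in> \<pi>; C \<in> \<pi>\<rbrakk> \<Longrightarrow> connected_coalition G B C \<longleftrightarrow> B \<noteq> C \<and> (B = A \<or> C = A)"
  shows "digraph_iso (with_proj (CCG G \<pi>)) (with_proj (star (card \<pi>)))"
proof -
  let ?k = "card \<pi>" and ?C = "CCG G \<pi>"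
  \<comment> \<open>The centre goes to 0, and the other sets are numbered from 1 in any
    order.\<close>
  have "card (\<pi> - {A}) = card {1..<?k}" using assms(1,2) by simp
  then obtain g where "bij_betw g (\<pi> - {A}) {1..<?k}"
    using assms(1) finite_same_card_bij[of "\<pi> - {A}" "{1..<?k}"] by auto
  then have g: "inj_on g (\<pi> - {A})" "g ` (\<pi> - {A}) = {1..<?k}" by (auto simp: bij_betw_def)
  define f where "f = g(A := 0)"
  have fA: "f A = 0" by (simp add: f_def)
  have img: "f ` (\<pi> - {A}) = {1..<?k}" using g(2) by (auto simp: f_def image_def)
  have "0 < ?k" using assms(1,2) card_gt_0_iff by blast
  have "f ` \<pi> = insert 0 (f ` (\<pi> - {A}))" using assms(2) fA by auto
  then have f_img: "f ` \<pi> = {..<?k}" using img \<open>0 < ?k\<close> by auto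
  then have inj: "inj_on f \<pi>" using assms(1) by (intro eq_card_imp_inj_on) auto
  have arcs: "parcs ?C = {A} \<times> (\<pi> - {A}) \<union> (\<pi> - {A}) \<times> {A}"
    using R assms(2) by (auto simp: CCG_def)
  have "map_prod f f ` parcs ?C = {0} \<times> {1..<?k} \<union> {1..<?k} \<times> {0}"
    unfolding arcs image_Un map_prod_surj_on[OF refl refl] img by (simp add: fA)
  also have "\<dots> = parcs (star ?k)" by (auto simp: star_def)
  finally have arcs_img: "map_prod f f ` parcs ?C = parcs (star ?k)" .
  \<comment> \<open>\<open>digraph_iso\<close> also asks for a map of arcs and for the new head and
    tail functions; arcs are pairs here, so both ends are mapped by \<open>f\<close>.\<close>
  define h where "h = \<lparr>iso_verts = f, iso_arcs = map_prod f f,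
    iso_head = snd :: nat \<times> nat \<Rightarrow> nat, iso_tail = fst\<rparr>"
  have sub: "parcs ?C \<subseteq> \<pi> \<times> \<pi>" by (auto simp: CCG_def)
  have "inj_on (map_prod f f) (parcs ?C)"
    using map_prod_inj_on[OF inj inj] sub inj_on_subset by blast
  moreover have "wf_digraph (with_proj ?C)"
    by unfold_locales (auto simp: CCG_def)
  ultimately have "pre_digraph.digraph_isomorphism (with_proj ?C) h"
    using inj by (auto simp: pre_digraph.digraph_isomorphism_def h_def CCG_def)
  moreover have "with_proj (star ?k) = app_iso h (with_proj ?C)"
    using f_img arcs_img by (simp add: with_proj_def app_iso_def h_def CCG_def star_def)
  ultimately show ?thesis unfolding digraph_iso_def by blast
qed

lemma subcubic_imp_subcubic_pair_graph: "subcubic G \<Longrightarrow> subcubic_pair_graph G"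
  by (simp add: subcubic_def subcubic_pair_graph_def subcubic_pair_graph_axioms_def)

section \<open>Sharpness: criteria and small orders\<close>

text \<open>Any coalition of an example supplies the connected dominating set from which the whole
  graph inherits connectedness.\<close>

lemma subcubicI:
  assumes "finite V" "E \<subseteq> V \<times> V" "sym E" "irrefl E" "\<And>v. v \<in> V \<Longrightarrow> card (E `` {v}) \<le> 3"
    and cds: "connected_dominating_set \<lparr>pverts = V, parcs = E\<rparr> D"
  shows "subcubic \<lparr>pverts = V, parcs = E\<rparr>"
proof -
  let ?H = "\<lparr>pverts = V, parcs = E\<rparr>"
  have "finite E" using assms(1,2) finite_subset by blast
  then have "pair_graph ?H"
    using assms(1-4) by unfold_locales (auto simp: symmetric_def irrefl_def)
  moreover have "connected (with_proj ?H)"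
  proof -
    have "with_proj ?H \<restriction> V = with_proj ?H"
      using assms(2) by (auto simp: induce_subgraph_def with_proj_def)
    moreover have "conn E V"
      using cds \<open>sym E\<close> conn_dominated[of E D V] by (simp add: connected_dominating_set_iff)
    ultimately show ?thesis using connected_induce_iff_conn[of ?H V] \<open>sym E\<close> by simp
  qed
  ultimately show ?thesis using assms(5) by (simp add: subcubic_def out_degree_with_proj)
qed

lemma connected_coalition_partitionI:
  assumes "partition_on (pverts G) \<pi>"
    and "\<And>A. A \<in> \<pi> \<Longrightarrow> \<not> connected_dominating_set G A"
    and "\<And>A. A \<in> \<pi> \<Longrightarrow> \<exists>B\<in>\<pi>. B \<noteq> A \<and> connected_dominating_set G (A \<union> B)"
  shows "connected_coalition_partition G \<pi>"
  unfolding connected_coalition_partition_def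
proof (intro conjI ballI disjI2 assms(1))
  fix A assume "A \<in> \<pi>"
  then obtain B where "B \<in> \<pi>" "B \<noteq> A" "connected_dominating_set G (A \<union> B)"
    using assms(3) by blast
  moreover from this have "A \<inter> B = {}" "A \<subseteq> pverts G" "B \<subseteq> pverts G"
    using assms(1) \<open>A \<in> \<pi>\<close> by (auto simp: partition_on_def dest: disjointD)
  ultimately show "\<exists>B\<in>\<pi>. connected_coalition G A B"
    using assms(2) \<open>A \<in> \<pi>\<close> by (auto simp: connected_coalition_def)
qed

lemma CC_eqI:
  assumes "subcubic G" "connected_coalition_partition G \<pi>"
    and "card \<pi> = max 6 ((card (pverts G) + 7) div 3)"
  shows "CC G = max 6 ((card (pverts G) + 7) div 3)"
proof -
  interpret subcubic_pair_graph G using assms(1) by (rule subcubic_imp_subcubic_pair_graph)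
  show ?thesis using CC_le card_partition_le_CC[OF assms(2)] unfolding assms(3) by (rule order_antisym)
qed

definition symrel :: "('a \<times> 'a) list \<Rightarrow> 'a rel" where
  "symrel es = set es \<union> (set es)\<inverse>"

text \<open>An executable certificate of connectedness, to be read from the end of the list.\<close>

fun grown :: "('a \<times> 'a) list \<Rightarrow> 'a list \<Rightarrow> bool" where
  "grown es [] = False"
| "grown es [x] = True"
| "grown es (x # y # ys) =
     (list_ex (\<lambda>u. (u, x) \<in> set es \<or> (x, u) \<in> set es) (y # ys) \<and> grown es (y # ys))"

lemma sym_symrel: "sym (symrel es)"
  by (auto simp: sym_def symrel_def)

lemma conn_if_grown: "grown es xs \<Longrightarrow> conn (symrel es) (set xs)"
proof (induction es xs rule: grown.induct)
  case (3 es x y ys)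
  then obtain u where "u \<in> set (y # ys)" "(u, x) \<in> symrel es"
    by (auto simp: list_ex_iff symrel_def)
  with 3 show ?case
    using conn_insert[OF sym_symrel, of es "set (y # ys)" u x] by simp
qed (simp_all add: conn_singleton)

text \<open>Each list of \<open>ds\<close> is to enumerate the union of two blocks in an order in which every vertex
  but the last has a later neighbour.\<close>

lemma sharp_if_edge_list:
  assumes edges: "list_all (\<lambda>(a, b). a < b \<and> b < n) es"
    and deg: "list_all (\<lambda>v. length (filter (\<lambda>(a, b). a = v \<or> b = v) es) \<le> 3) [0..<n]"
    and blocks: "sort (concat bs) = [0..<n]" "[] \<notin> set bs" "distinct bs"
    and small: "list_all (\<lambda>b. 2 * length b + 2 < n) bs"
    and doms: "list_all (\<lambda>d. grown es d \<and> list_all (\<lambda>v. v \<in> set d \<or>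
        list_ex (\<lambda>u. (u, v) \<in> set es \<or> (v, u) \<in> set es) d) [0..<n] \<and> list_all (\<lambda>v. v < n) d) ds"
    and partners: "list_all (\<lambda>b. list_ex (\<lambda>c. c \<noteq> b \<and> list_ex (\<lambda>d. set d = set (b @ c)) ds) bs) bs"
    and card: "length bs = max 6 ((n + 7) div 3)" "0 < n"
  shows "\<exists>H :: nat pair_pre_digraph. subcubic H \<and> card (pverts H) = n \<and> CC H = max 6 ((n + 7) div 3)"
proof -
  let ?E = "symrel es"
  let ?H = "\<lparr>pverts = {..<n}, parcs = ?E\<rparr>"
  have cds_ds: "connected_dominating_set ?H (set d)" if "d \<in> set ds" for d
    using that doms conn_if_grown[of es d] sym_symrel[of es]
    by (fastforce simp: connected_dominating_set_iff list_all_iff list_ex_iff symrel_def)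
  have partner: "\<exists>c\<in>set bs. c \<noteq> b \<and> connected_dominating_set ?H (set b \<union> set c)"
    if "b \<in> set bs" for b
    using that partners cds_ds by (fastforce simp: list_all_iff list_ex_iff)
  have "bs \<noteq> []" using card by auto
  then have "hd bs \<in> set bs" by simp
  then obtain D where D: "connected_dominating_set ?H D" using partner by blast
  have H: "subcubic ?H"
  proof (rule subcubicI[OF _ _ _ _ _ D])
    show "card (?E `` {v}) \<le> 3" if "v \<in> {..<n}" for v
    proof -
      let ?es = "filter (\<lambda>(a, b). a = v \<or> b = v) es"
      \<comment> \<open>Sending an incident edge to its other end covers all neighbours.\<close>
      have "?E `` {v} \<subseteq> (\<lambda>(a, b). if a = v then b else a) ` set ?es"
        by (force simp: symrel_def)
      then have "card (?E `` {v}) \<le> card ((\<lambda>(a, b). if a = v then b else a) ` set ?es)"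
        by (intro card_mono) auto
      also have "\<dots> \<le> card (set ?es)" by (intro card_image_le) simp
      also have "\<dots> \<le> length ?es" by (rule card_length)
      also have "\<dots> \<le> 3" using deg that by (simp add: list_all_iff)
      finally show ?thesis .
    qed
  qed (use edges sym_symrel in \<open>auto simp: symrel_def irrefl_def list_all_iff\<close>)
  then interpret H: subcubic_pair_graph ?H by (rule subcubic_imp_subcubic_pair_graph)
  \<comment> \<open>Sorting to \<open>[0..<n]\<close> says that the blocks jointly list each vertex
    exactly once.\<close>
  have "distinct (concat bs)" "set (concat bs) = {..<n}"
    using blocks(1) by (metis distinct_sort distinct_upt, metis atLeast_upt set_sort)
  then have bs: "\<And>b. b \<in> set bs \<Longrightarrow> distinct b" "\<Union> (set ` set bs) = {..<n}"
    "\<And>b c. \<lbrakk>b \<in> set bs; c \<in> set bs; b \<noteq> c\<rbrakk> \<Longrightarrow> set b \<inter> set c = {}"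
    by (auto simp: distinct_concat_iff)
  have inj: "inj_on set (set bs)"
    using bs(3) blocks(2) by (intro inj_onI) (metis Int_absorb set_empty)
  let ?\<pi> = "set ` set bs"
  have "connected_coalition_partition ?H ?\<pi>"
  proof (rule connected_coalition_partitionI)
    show "partition_on (pverts ?H) ?\<pi>"
      unfolding partition_on_def
    proof (intro conjI disjointI)
      fix A B assume "A \<in> ?\<pi>" "B \<in> ?\<pi>" "A \<noteq> B"
      then obtain b c where "b \<in> set bs" "c \<in> set bs" "b \<noteq> c" "A = set b" "B = set c" by blast
      then show "A \<inter> B = {}" using bs(3) by simp
    qed (use bs(2) blocks(2) in auto)
  next
    fix A assume "A \<in> ?\<pi>"
    then obtain b where b: "b \<in> set bs" "A = set b" by blast
    then have "2 * card A + 2 < n"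
      using small bs(1)[OF b(1)] by (auto simp: list_all_iff distinct_card)
    then show "\<not> connected_dominating_set ?H A"
      using H.card_le_connected_dominating_set[of A] by auto
    show "\<exists>B\<in>?\<pi>. B \<noteq> A \<and> connected_dominating_set ?H (A \<union> B)"
      using partner[OF b(1)] b inj_on_eq_iff[OF inj] by auto
  qed
  moreover have "card ?\<pi> = max 6 ((card (pverts ?H) + 7) div 3)"
    using card inj blocks(3) by (simp add: card_image distinct_card)
  ultimately have "CC ?H = max 6 ((card (pverts ?H) + 7) div 3)" by (rule CC_eqI[OF H])
  then show ?thesis using H by (intro exI[of _ ?H]) simp
qed

text \<open>In the complete bipartite graph K_{3,3} the two ends of any edge dominate, so a perfect
  matching pairs up the six singletons.\<close>

lemma sharp_order_6:
  "\<exists>H :: nat pair_pre_digraph. subcubic H \<and> card (pverts H) = 6 \<and> CC H = max 6 ((6 + 7) div 3)"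
  by (rule sharp_if_edge_list[where
      es = "[(0,3),(0,4),(0,5),(1,3),(1,4),(1,5),(2,3),(2,4),(2,5)]" and
      bs = "[[0],[1],[2],[3],[4],[5]]" and
      ds = "[[0,3],[1,4],[2,5]]"]) code_simp+

text \<open>Coalition stars with six sets need order at least 11, so the partitions for the orders 8 and
  10, found by computer search, have two disjoint edges in their coalition graphs.\<close>

lemma sharp_order_8:
  "\<exists>H :: nat pair_pre_digraph. subcubic H \<and> card (pverts H) = 8 \<and> CC H = max 6 ((8 + 7) div 3)"
  by (rule sharp_if_edge_list[where
      es = "[(0,2),(0,3),(0,4),(1,2),(1,4),(1,5),(2,6),(3,5),(3,7),(4,7),(5,6),(6,7)]" and
      bs = "[[0,2],[1,4],[3],[5],[6],[7]]" and
      ds = "[[3,0,2],[6,2,0],[5,1,4],[7,4,1]]"]) code_simp+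

lemma sharp_order_10:
  "\<exists>H :: nat pair_pre_digraph. subcubic H \<and> card (pverts H) = 10 \<and> CC H = max 6 ((10 + 7) div 3)"
  by (rule sharp_if_edge_list[where
      es = "[(0,1),(0,6),(0,8),(1,3),(1,4),(2,3),(2,5),(2,9),(3,8),(4,6),(4,7),(5,6),(5,7),(7,9),(8,9)]" and
      bs = "[[0,5,6],[2],[1,4,7],[3],[8],[9]]" and
      ds = "[[0,6,5,2],[8,0,6,5],[3,1,4,7],[9,7,4,1]]"]) code_simp+

section \<open>Sharpness: the two-path graphs of order at least 11\<close>

text \<open>The attachment point of the leaf \<open>j < p\<close> on a path \<open>s, \<dots>, l\<close>: the first vertex takes the
  leaves 0 and 1, and the last vertex takes in particular the leaf \<open>p - 1\<close>.\<close>

definition attach :: "nat \<Rightarrow> nat \<Rightarrow> nat \<Rightarrow> nat \<Rightarrow> nat" where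
  "attach p s l j = (if j + 1 = p then l else s + (j - 1))"

text \<open>The first hypothesis says that \<open>p\<close> exceeds the number
  \<open>l - s + 1\<close> of path vertices by at most 2: only the two ends have room for a second
  leaf.\<close>

lemma attach_range:
  assumes "s + p \<le> l + 3" "3 \<le> p" "j < p" "s \<le> l"
  shows "attach p s l j \<in> {s..l}"
  using assms by (auto simp: attach_def)

lemma card_path_neighbours:
  assumes "s < l" "v \<in> {s..l}" "3 \<le> p" and
    N: "\<And>w. w \<in> N \<Longrightarrow> (w = v + 1 \<and> v \<noteq> l) \<or> (w + 1 = v \<and> v \<noteq> s) \<or>
      (\<exists>j<p. w = q + j \<and> v = attach p s l j)"
  shows "card N \<le> 3"
proof -
  have bound: "card N \<le> 3" if "N \<subseteq> {a, b, c}" for a b c :: nat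
    using card_mono[OF _ that] card_length[of "[a, b, c]"] by simp
  consider "v = s" | "v = l" | "v \<noteq> s" "v \<noteq> l" by blast
  then show ?thesis
  proof cases
    case 1
    \<comment> \<open>Truncated subtraction sends both leaves 0 and 1 to \<open>s\<close>.\<close>
    have "N \<subseteq> {v + 1, q, q + 1}"
      using 1 assms(1,3) N by (fastforce simp: attach_def split: if_splits)
    then show ?thesis by (rule bound)
  next
    case 2
    \<comment> \<open>Besides the leaf \<open>p - 1\<close>, the last vertex may get the leaf
      \<open>l - s + 1\<close> by the regular rule.\<close>
    have "N \<subseteq> {v - 1, q + (p - 1), q + (l - s + 1)}"
      using 2 assms(1,3) N by (fastforce simp: attach_def split: if_splits)
    then show ?thesis by (rule bound)
  next
    case 3
    have "N \<subseteq> {v - 1, v + 1, q + (v - s + 1)}"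
      using 3 assms(1-3) N by (fastforce simp: attach_def split: if_splits)
    then show ?thesis by (rule bound)
  qed
qed

lemma conn_path:
  fixes s l :: nat
  assumes "sym E" "s \<le> l" "\<And>i. s \<le> i \<Longrightarrow> i < l \<Longrightarrow> (i, i + 1) \<in> E"
  shows "conn E {s..l}"
  using assms(2,3)
proof (induction l rule: dec_induct)
  case base
  then show ?case by (simp add: conn_singleton)
next
  case (step l)
  then have "conn E (insert (Suc l) {s..l})"
    using conn_insert[OF assms(1), of "{s..l}" l "Suc l"] by simp
  then show ?case using step(1) by (simp add: atLeastAtMostSuc_conv)
qed

text \<open>Two disjoint paths \<open>0, \<dots>, m - 1\<close> and \<open>m, \<dots>, q - 1\<close>, and \<open>p\<close> further vertices
  \<open>q, \<dots>, q + p - 1\<close>, each joined to one vertex of either path.\<close>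

definition two_paths_arc :: "nat \<Rightarrow> nat \<Rightarrow> nat \<Rightarrow> nat \<Rightarrow> nat \<Rightarrow> bool" where
  "two_paths_arc m q p v w \<longleftrightarrow> (w = v + 1 \<and> w < q \<and> w \<noteq> m) \<or>
     (\<exists>j<p. v = q + j \<and> (w = attach p 0 (m - 1) j \<or> w = attach p m (q - 1) j))"

text \<open>One block consists of both paths and every leaf is a block of its own. The paths
  dominate but are disconnected, and any single leaf joins them.\<close>

lemma sharp_order_ge_11:
  assumes "11 \<le> n"
  shows "\<exists>H :: nat pair_pre_digraph. subcubic H \<and> card (pverts H) = n \<and> CC H = max 6 ((n + 7) div 3)"
proof -
  \<comment> \<open>\<open>p + 1\<close> is the required number of sets, \<open>m\<close> the least
    length of a path that can carry \<open>p\<close> leaves; the second path takes all remaining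
    vertices, at least \<open>m\<close> by the choice of \<open>p\<close>.\<close>
  define p m q where "p = (n + 4) div 3" and "m = p - 2" and "q = n - p"
  have arith: "3 \<le> m" "p = m + 2" "2 * m \<le> q" "q + p = n" "max 6 ((n + 7) div 3) = p + 1"
    using assms unfolding p_def m_def q_def by linarith+
  define E where "E = {(v, w). two_paths_arc m q p v w \<or> two_paths_arc m q p w v}"
  let ?H = "\<lparr>pverts = {..<n}, parcs = E\<rparr>"
  have "sym E" by (auto simp: E_def sym_def)
  have att: "attach p 0 (m - 1) j \<in> {0..m - 1}" "attach p m (q - 1) j \<in> {m..q - 1}" if "j < p" for j
    using attach_range[of 0 p "m - 1" j] attach_range[of m p "q - 1" j] that arith by auto
  have leaf: "(q + j, attach p 0 (m - 1) j) \<in> E" "(q + j, attach p m (q - 1) j) \<in> E" if "j < p" for j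
    using that by (auto simp: E_def two_paths_arc_def)
  have "(i, Suc i) \<in> E" if "Suc i < q" "Suc i \<noteq> m" for i
    using that by (simp add: E_def two_paths_arc_def)
  then have conn: "conn E {0..m - 1}" "conn E {m..q - 1}"
    by (rule_tac conn_path[OF \<open>sym E\<close>]; use arith in simp)+
  have split: "{..<q} = {0..m - 1} \<union> {m..q - 1}" using arith by auto
  have cds: "connected_dominating_set ?H (insert (q + j) {..<q})" if "j < p" for j
  proof -
    have "conn E (insert (q + j) {0..m - 1})"
      using leaf(1)[OF that] att(1)[OF that] \<open>sym E\<close>
      by (intro conn_insert[OF \<open>sym E\<close> conn(1), of "attach p 0 (m - 1) j"]) (auto dest: symD)
    then have "conn E (insert (q + j) {0..m - 1} \<union> {m..q - 1})"
      by (rule conn_Un[OF \<open>sym E\<close> _ conn(2) insertI1 att(2)[OF that] leaf(2)[OF that]])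
    then have "conn E (insert (q + j) {..<q})" unfolding split by simp
    moreover have "\<exists>u\<in>insert (q + j) {..<q}. (v, u) \<in> E" if "v \<in> {..<n} - insert (q + j) {..<q}" for v
    proof -
      have "v = q + (v - q)" "v - q < p" using that arith by auto
      then show ?thesis using leaf(1)[of "v - q"] att(1)[of "v - q"] arith
        by (intro bexI[of _ "attach p 0 (m - 1) (v - q)"]) auto
    qed
    ultimately show ?thesis
      using \<open>j < p\<close> arith \<open>sym E\<close> by (auto simp: connected_dominating_set_iff)
  qed
  have "\<not> conn E {..<q}"
  proof
    assume "conn E {..<q}"
    moreover have "{0..m - 1} \<inter> {..<q} \<noteq> {}" using arith by auto
    \<comment> \<open>No arc joins \<open>m - 1\<close> to \<open>m\<close>, so the first path is
      closed in the union of the paths.\<close>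
    moreover have "E `` ({0..m - 1} \<inter> {..<q}) \<inter> {..<q} \<subseteq> {0..m - 1}"
      using arith by (auto simp: E_def two_paths_arc_def)
    ultimately have "{..<q} \<subseteq> {0..m - 1}" by (rule conn_closed)
    moreover have "m \<in> {..<q}" "m \<notin> {0..m - 1}" using arith by auto
    ultimately show False by blast
  qed
  then have paths: "\<not> connected_dominating_set ?H {..<q}"
    using \<open>sym E\<close> by (simp add: connected_dominating_set_iff)
  have nbr: "(w = v + 1 \<and> w < q \<and> w \<noteq> m) \<or> (w + 1 = v \<and> v \<noteq> m) \<or>
      (\<exists>j<p. w = q + j \<and> (v = attach p 0 (m - 1) j \<or> v = attach p m (q - 1) j))"
    if "w \<in> E `` {v}" "v < q" for v w
    using that by (auto simp: E_def two_paths_arc_def)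
  have H: "subcubic ?H"
  proof (rule subcubicI[OF _ _ \<open>sym E\<close> _ _ cds])
    show "E \<subseteq> {..<n} \<times> {..<n}"
      using att arith by (fastforce simp: E_def two_paths_arc_def)
    show "irrefl E"
      using att arith by (fastforce simp: E_def two_paths_arc_def irrefl_def)
    show "card (E `` {v}) \<le> 3" if "v \<in> {..<n}" for v
    proof -
      consider "v \<in> {0..m - 1}" | "v \<in> {m..q - 1}" | "q \<le> v" using arith by fastforce
      then show ?thesis
      proof cases
        case 1
        show ?thesis
        proof (rule card_path_neighbours[OF _ 1])
          fix w assume "w \<in> E `` {v}"
          moreover have "v < q" using 1 arith by auto
          moreover have "v \<noteq> attach p m (q - 1) j" if "j < p" for j
            using att(2)[OF that] 1 arith by auto
          ultimately show "(w = v + 1 \<and> v \<noteq> m - 1) \<or> (w + 1 = v \<and> v \<noteq> 0) \<or>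
              (\<exists>j<p. w = q + j \<and> v = attach p 0 (m - 1) j)"
            using nbr[of w v] 1 arith by auto
        qed (use arith in auto)
      next
        case 2
        show ?thesis
        proof (rule card_path_neighbours[OF _ 2])
          fix w assume "w \<in> E `` {v}"
          moreover have "v < q" using 2 arith by auto
          moreover have "v \<noteq> attach p 0 (m - 1) j" if "j < p" for j
            using att(1)[OF that] 2 arith by auto
          ultimately show "(w = v + 1 \<and> v \<noteq> q - 1) \<or> (w + 1 = v \<and> v \<noteq> m) \<or>
              (\<exists>j<p. w = q + j \<and> v = attach p m (q - 1) j)"
            using nbr[of w v] 2 arith by auto
        qed (use arith in auto)
      next
        case 3
        have "E `` {v} \<subseteq> {attach p 0 (m - 1) (v - q), attach p m (q - 1) (v - q)}"
          using 3 arith att by (fastforce simp: E_def two_paths_arc_def)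
        then have "card (E `` {v}) \<le> card {attach p 0 (m - 1) (v - q), attach p m (q - 1) (v - q)}"
          by (intro card_mono) auto
        also have "\<dots> \<le> 3" by (simp add: card_insert_if)
        finally show ?thesis .
      qed
    qed
    show "0 < p" using arith by simp
  qed simp
  then interpret H: subcubic_pair_graph ?H by (rule subcubic_imp_subcubic_pair_graph)
  let ?\<pi> = "insert {..<q} ((\<lambda>j. {q + j}) ` {..<p})"
  have "connected_coalition_partition ?H ?\<pi>"
  proof (rule connected_coalition_partitionI)
    have "(\<lambda>j. q + j) ` {..<p} = {q..<n}"
      using image_add_atLeastLessThan[of q 0 p] arith(4) by (simp add: lessThan_atLeast0 add.commute)
    then have "{..<n} = {..<q} \<union> (\<lambda>j. q + j) ` {..<p}" using arith(4) by auto
    then have "\<Union> ?\<pi> = {..<n}" by (simp add: UNION_singleton_eq_range)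
    moreover have "disjoint ?\<pi>" by (auto simp: pairwise_def disjnt_def)
    moreover have "0 \<in> {..<q}" using arith by simp
    then have "{} \<notin> ?\<pi>" by blast
    ultimately show "partition_on (pverts ?H) ?\<pi>"
      by (simp add: partition_on_def)
  next
    fix A assume A: "A \<in> ?\<pi>"
    \<comment> \<open>A single vertex could be a connected dominating set only up to order
      4.\<close>
    have "\<not> connected_dominating_set ?H {q + j}" for j
      using H.card_le_connected_dominating_set[of "{q + j}"] assms by auto
    then show "\<not> connected_dominating_set ?H A" using A paths by auto
    have neq: "{q + j} \<noteq> {..<q}" for j by auto
    show "\<exists>B\<in>?\<pi>. B \<noteq> A \<and> connected_dominating_set ?H (A \<union> B)"
    proof (cases "A = {..<q}")
      case True
      then show ?thesis using cds[of 0] neq[of 0] arith by (intro bexI[of _ "{q + 0}"]) auto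
    next
      case False
      then obtain j where "j < p" "A = {q + j}" using A by auto
      then show ?thesis using cds[of j] neq[of j] by (intro bexI[of _ "{..<q}"]) auto
    qed
  qed
  moreover have "card ?\<pi> = max 6 ((card (pverts ?H) + 7) div 3)"
  proof -
    have "card ((\<lambda>j. {q + j}) ` {..<p}) = p" by (simp add: card_image inj_on_def)
    moreover have "{..<q} \<notin> (\<lambda>j. {q + j}) ` {..<p}" by auto
    ultimately show ?thesis using arith(5) by simp
  qed
  ultimately have "CC ?H = max 6 ((card (pverts ?H) + 7) div 3)" by (rule CC_eqI[OF H])
  then show ?thesis using H by (intro exI[of _ ?H]) simp
qed

theorem theorem3:
  shows "(\<forall>G :: 'a pair_pre_digraph. subcubic G \<longrightarrow>
            (\<forall>\<pi>. connected_coalition_partition G \<pi> \<longrightarrow>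
                  card \<pi> \<le> max 6 ((card (pverts G) + 7) div 3)) \<and>
            CC G \<le> max 6 ((card (pverts G) + 7) div 3) \<and>
            (CC G > 6 \<longrightarrow>
              (\<forall>\<pi>. connected_coalition_partition G \<pi> \<and> card \<pi> = CC G \<longrightarrow>
                    digraph_iso (with_proj (CCG G \<pi>)) (with_proj (star (CC G)))))) \<and>
         (\<forall>n :: nat. n \<in> {6, 8} \<or> n \<ge> 10 \<longrightarrow>
            (\<exists>H :: nat pair_pre_digraph. subcubic H \<and> card (pverts H) = n \<and>
                  CC H = max 6 ((n + 7) div 3)))"
proof (intro conjI allI impI)
  fix G :: "'a pair_pre_digraph" assume "subcubic G"
  then interpret subcubic_pair_graph G by (rule subcubic_imp_subcubic_pair_graph)
  show "card \<pi> \<le> max 6 ((card (pverts G) + 7) div 3)" if "connected_coalition_partition G \<pi>" for \<pi>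
    using that by (rule card_partition_le)
  show "CC G \<le> max 6 ((card (pverts G) + 7) div 3)" by (rule CC_le)
  fix \<pi> assume "6 < CC G" and \<pi>: "connected_coalition_partition G \<pi> \<and> card \<pi> = CC G"
  then have "6 < card \<pi>" by simp
  then obtain A where "A \<in> \<pi>"
    "\<And>B C. \<lbrakk>B \<in> \<pi>; C \<in> \<pi>\<rbrakk> \<Longrightarrow> connected_coalition G B C \<longleftrightarrow> B \<noteq> C \<and> (B = A \<or> C = A)"
    using coalition_star \<pi> by blast
  \<comment> \<open>An infinite \<open>\<pi>\<close> would have cardinality 0.\<close>
  moreover have "finite \<pi>" using \<open>6 < card \<pi>\<close> by (rule_tac card_ge_0_finite) simp
  ultimately have "digraph_iso (with_proj (CCG G \<pi>)) (with_proj (star (card \<pi>)))"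
    by (intro digraph_iso_star)
  then show "digraph_iso (with_proj (CCG G \<pi>)) (with_proj (star (CC G)))" using \<pi> by simp
next
  fix n :: nat assume "n \<in> {6, 8} \<or> n \<ge> 10"
  then consider "n = 6" | "n = 8" | "n = 10" | "11 \<le> n" by force
  then show "\<exists>H :: nat pair_pre_digraph. subcubic H \<and> card (pverts H) = n \<and>
      CC H = max 6 ((n + 7) div 3)"
    by cases (use sharp_order_6 sharp_order_8 sharp_order_10 sharp_order_ge_11 in blast)+
qed

end
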